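(* Let $N$ be a finite set with $|N|\geq 2$. Consider the polyhedron of vectors $c\in\mathbb{R}^{\mathcal{P}(N)}$ given by the constraints (a) $c(S)=1$ for all $S\subseteq N$ with $|S|\leq 1$; (b) $0\leq\sum_{S\subseteq N}\kappa_{\mathcal{A}}(S)\cdot c(S)$ for every non-empty class $\mathcal{A}$ of non-empty subsets of $N$ which is closed under supersets; (c) $|C|-1-\sum_{S\subseteq C,\,|S|\geq 2}c(S)\cdot(-1)^{|S|}\geq 0$ for every $C\subseteq N$ with $|C|\geq 2$. Then the only lattice points (vectors with integer components) in this polyhedron are characteristic imsets; that is, every lattice point $c$ in it equals $c_G$ for some acyclic directed graph $G$ over $N$.
   Context: $\mathcal{P}(N)$ is the power set of $N$. A class $\mathcal{A}$ of subsets of $N$ is closed under supersets if $S\in\mathcal{A}$, $S\subseteq T\subseteq N$ implies $T\in\mathcal{A}$. For a non-empty class $\mathcal{A}$ of non-empty subsets of $N$ closed under supersets, $$\kappa_{\mathcal{A}}(S)=\sum_{T\in\mathcal{A},\,T\subseteq S}(-1)^{|S\setminus T|}\qquad\text{for }S\subseteq N.$$ A directed graph over $N$ has node set $N$ and a collection of arrows $j\to i$ with $i,j\in N$, $i\neq j$; $\mathrm{pa}_G(i)=\{j\in N;\ j\to i\text{ in }G\}$. It is acyclic if it has no directed cycle (sequence $i_1,\ldots,i_n$, $n\geq 3$, with $i_r\to i_{r+1}$ for $r=1,\ldots,n-1$ and $i_n=i_1$). For $A\subseteq N$, $\delta_A\in\mathbb{R}^{\mathcal{P}(N)}$ is the vector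 with $\delta_A(A)=1$ and $\delta_A(S)=0$ for $S\neq A$. For an acyclic directed graph $G$ over $N$ the standard imset is $$u_G=\delta_N-\delta_{\emptyset}+\sum_{i\in N}\left[\delta_{\mathrm{pa}_G(i)}-\delta_{\{i\}\cup\mathrm{pa}_G(i)}\right],$$ and the characteristic imset $c_G$ is given by $c_G(S)=1-\sum_{T,\,S\subseteq T\subseteq N}u_G(T)$ for $S\subseteq N$ (one always has $c_G(S)=1$ for $|S|\leq 1$). *)

theory Defs
  imports Complex_Main "HOL-Library.FuncSet"
begin

text \<open>
  A vector indexed by the subsets of \<open>N\<close> is an element of \<^term>\<open>Pow N \<rightarrow>\<^sub>E (UNIV :: real set)\<close>: it
  takes the dummy value \<^const>\<open>undefined\<close> off \<^term>\<open>Pow N\<close>, so equality of vectors is equality of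
  functions.
\<close>

definition superset_closed_class :: "'a set \<Rightarrow> 'a set set \<Rightarrow> bool" where
  "superset_closed_class N \<A> \<longleftrightarrow>
     \<A> \<noteq> {} \<and> \<A> \<subseteq> Pow N \<and> {} \<notin> \<A> \<and>
     (\<forall>S T. S \<in> \<A> \<longrightarrow> S \<subseteq> T \<longrightarrow> T \<subseteq> N \<longrightarrow> T \<in> \<A>)"

definition kappa :: "'a set set \<Rightarrow> 'a set \<Rightarrow> real" where
  "kappa \<A> S = (\<Sum>T \<in> {T \<in> \<A>. T \<subseteq> S}. (-1) ^ card (S - T))"

text \<open>
  A directed graph is its set of arrows, with \<open>(j, i)\<close> standing for \<open>j \<rightarrow> i\<close>. Loops are excluded,
  so a directed cycle \<open>i\<^sub>1, \<dots>, i\<^sub>n = i\<^sub>1\<close> automatically has \<open>n \<ge> 3\<close>, and its absence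
  is the library predicate \<^const>\<open>acyclic\<close>.
\<close>

definition digraph_over :: "'a set \<Rightarrow> 'a rel \<Rightarrow> bool" where
  "digraph_over N G \<longleftrightarrow> G \<subseteq> N \<times> N \<and> irrefl G"

definition parents :: "'a set \<Rightarrow> 'a rel \<Rightarrow> 'a \<Rightarrow> 'a set" where
  "parents N G i = {j \<in> N. (j, i) \<in> G}"

definition delta :: "'a set \<Rightarrow> 'a set \<Rightarrow> 'a set \<Rightarrow> real" where
  "delta N A = (\<lambda>S \<in> Pow N. if S = A then 1 else 0)"

definition standard_imset :: "'a set \<Rightarrow> 'a rel \<Rightarrow> 'a set \<Rightarrow> real" where
  "standard_imset N G = (\<lambda>S \<in> Pow N.
     delta N N S - delta N {} S
     + (\<Sum>i \<in> N. delta N (parents N G i) S - delta N ({i} \<union> parents N G i) S))"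

definition characteristic_imset :: "'a set \<Rightarrow> 'a rel \<Rightarrow> 'a set \<Rightarrow> real" where
  "characteristic_imset N G = (\<lambda>S \<in> Pow N.
     1 - (\<Sum>T \<in> {T. S \<subseteq> T \<and> T \<subseteq> N}. standard_imset N G T))"

definition imset_polyhedron :: "'a set \<Rightarrow> ('a set \<Rightarrow> real) set" where
  "imset_polyhedron N = {c \<in> Pow N \<rightarrow>\<^sub>E UNIV.
     (\<forall>S. S \<subseteq> N \<longrightarrow> card S \<le> 1 \<longrightarrow> c S = 1) \<and>
     (\<forall>\<A>. superset_closed_class N \<A> \<longrightarrow> 0 \<le> (\<Sum>S \<in> Pow N. kappa \<A> S * c S)) \<and>
     (\<forall>C. C \<subseteq> N \<longrightarrow> 2 \<le> card C \<longrightarrow>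
        real (card C) - 1 - (\<Sum>S \<in> {S. S \<subseteq> C \<and> 2 \<le> card S}. c S * (-1) ^ card S) \<ge> 0)}"

end

theory Submission
  imports Defs
begin

text \<open>
  Write \<open>\<mu>\<close> for the Moebius inverse of \<open>c\<close> over supersets, so that \<open>c S\<close> is the sum of \<open>\<mu> T\<close> over
  \<open>T \<supseteq> S\<close>. In terms of \<open>\<mu>\<close> the constraints read: (a) the sum of all \<open>\<mu> T\<close> is 1, and for
  each \<open>i \<in> N\<close> the sum over the \<open>T\<close> containing \<open>i\<close> is 1; (b) the sum of \<open>\<mu>\<close> over every family of
  non-empty sets closed under supersets is non-negative; (c) the sum over the sets that avoid
  a cluster \<open>C\<close> with at least two elements is at most 0. On the other side, the characteristic
  imset of \<open>G\<close> is the vector with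
  \<open>\<mu> = \<delta>\<^sub>\<emptyset> + (\<Sum>i \<in> N. \<delta> ({i} \<union> pa i) - \<delta> (pa i))\<close>.
  So a parent set has to be found for every node, and the resulting graph must be acyclic.

  Let \<open>m = \<mu> - \<delta>\<^sub>\<emptyset>\<close>, an integer vector with total 0. By (b) its sum over every upset is
  non-negative. Regard a positive entry as a unit of mass that was lifted from a smaller set, where
  it left a negative entry. The key step (\<open>ex_lift_unit_removable\<close>) lowers one unit from
  a set \<open>B\<close> with \<open>m B > 0\<close> to some \<open>B - {i}\<close> while the upset sums stay non-negative. This is
  a discrete augmentation argument: the upsets with sum 0 are closed under intersection, so there is
  a least one that contains \<open>B\<close>; it contains some \<open>B - {i}\<close>, as otherwise \<open>B\<close> could be removed from it
  and the sum would drop below 0. Hence no upset with sum 0 separates \<open>B\<close> from \<open>B - {i}\<close>, and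
  since the sums are integers, all others can afford to lose a unit.

  A step at \<open>i\<close> lowers the sum over the sets containing \<open>i\<close> by 1 and leaves those for the other
  nodes unchanged. These sums are all 1 at the start and never negative, so each node is used exactly
  once: \<open>m\<close> is a sum of terms \<open>\<delta> (insert i (P i)) - \<delta> (P i)\<close>, one for each \<open>i \<in> N\<close>
  (\<open>decompose_into_lift_units\<close>). Take \<open>P i\<close> as the parent set of \<open>i\<close>. Summing \<open>m\<close> over the
  sets that avoid \<open>C\<close> counts, up to sign, the nodes \<open>i \<in> C\<close> without parents in \<open>C\<close>, so (c) says that
  every cluster has such a node, which excludes directed cycles.
\<close>

section \<open>Moebius inversion over supersets\<close>

definition upper_moebius :: "'a set \<Rightarrow> ('a set \<Rightarrow> real) \<Rightarrow> 'a set \<Rightarrow> real" where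
  "upper_moebius N f T = (\<Sum>S \<in> {S \<in> Pow N. T \<subseteq> S}. (-1) ^ card (S - T) * f S)"

lemma alternating_sum_Pow:
  assumes "finite X"
  shows "(\<Sum>S \<in> Pow X. (-1) ^ card S) = (of_bool (X = {}) :: real)"
proof -
  have "(\<Sum>S \<in> Pow X. (-1) ^ card S) = (\<Prod>x \<in> X. 1 - 1 :: real)"
    using prod_diff_conv_sum[OF assms, of "\<lambda>_. 1 :: real" "\<lambda>_. 1"] by simp
  then show ?thesis
    using assms by (simp add: power_0_left card_eq_0_iff)
qed

lemma alternating_sum_interval:
  assumes "finite S" "X \<subseteq> S"
  shows "(\<Sum>T \<in> {T. X \<subseteq> T \<and> T \<subseteq> S}. (-1) ^ card (S - T)) = (of_bool (S = X) :: real)"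
proof -
  have "(\<Sum>T \<in> {T. X \<subseteq> T \<and> T \<subseteq> S}. (-1) ^ card (S - T)) =
        (\<Sum>Y \<in> Pow (S - X). (-1) ^ card Y :: real)"
    by (rule sum.reindex_bij_witness[of _ "\<lambda>Y. S - Y" "\<lambda>T. S - T"])
       (use assms in \<open>auto simp: double_diff\<close>)
  then show ?thesis
    using alternating_sum_Pow[of "S - X"] assms by auto
qed

text \<open>
  The coefficient of \<open>f S\<close> on the right is \<open>kappa \<A> S\<close>: this turns the constraints (b) into
  statements about upset sums.
\<close>
lemma sum_upper_moebius:
  assumes "finite N" "\<A> \<subseteq> Pow N"
  shows "(\<Sum>T \<in> \<A>. upper_moebius N f T) =
         (\<Sum>S \<in> Pow N. (\<Sum>T \<in> {T \<in> \<A>. T \<subseteq> S}. (-1) ^ card (S - T)) * f S)"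
proof -
  have "finite \<A>"
    using assms finite_subset by blast
  then show ?thesis
    unfolding upper_moebius_def sum_distrib_right
    by (intro sum.swap_restrict) (use assms in auto)
qed

lemma upper_moebius_inversion:
  assumes "finite N" "X \<subseteq> N"
  shows "(\<Sum>T \<in> {T \<in> Pow N. X \<subseteq> T}. upper_moebius N f T) = f X"
proof -
  have "(\<Sum>T \<in> {T \<in> {T \<in> Pow N. X \<subseteq> T}. T \<subseteq> S}. (-1) ^ card (S - T)) * f S =
        of_bool (S = X) * f S" if "S \<in> Pow N" for S
  proof -
    have "{T \<in> {T \<in> Pow N. X \<subseteq> T}. T \<subseteq> S} = {T. X \<subseteq> T \<and> T \<subseteq> S}"
      using that by auto
    moreover have "(\<Sum>T \<in> {T. X \<subseteq> T \<and> T \<subseteq> S}. (-1) ^ card (S - T)) = (of_bool (S = X) :: real)"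
    proof (cases "X \<subseteq> S")
      case True
      then show ?thesis
        using that assms alternating_sum_interval[of S X] finite_subset[of S N] by auto
    next
      case False
      then have "{T. X \<subseteq> T \<and> T \<subseteq> S} = {}" "S \<noteq> X"
        by auto
      then show ?thesis
        by (simp only: sum.empty of_bool_eq)
    qed
    ultimately show ?thesis
      by simp
  qed
  moreover have "(\<Sum>T \<in> {T \<in> Pow N. X \<subseteq> T}. upper_moebius N f T) =
      (\<Sum>S \<in> Pow N. (\<Sum>T \<in> {T \<in> {T \<in> Pow N. X \<subseteq> T}. T \<subseteq> S}. (-1) ^ card (S - T)) * f S)"
    using assms(1) Collect_restrict by (rule sum_upper_moebius)
  ultimately have "(\<Sum>T \<in> {T \<in> Pow N. X \<subseteq> T}. upper_moebius N f T) =
                   (\<Sum>S \<in> Pow N. of_bool (S = X) * f S)"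
    by (simp only: cong: sum.cong)
  also have "\<dots> = f X"
    using assms by (simp add: of_bool_def if_distrib[of "\<lambda>b. b * _"] sum.delta' cong: if_cong)
  finally show ?thesis .
qed

text \<open>
  The left side is the expression in the cluster constraint (c), completed by the terms with
  \<open>card S \<le> 1\<close>. Each \<open>upper_moebius N f T\<close> enters it with the alternating sum over all subsets of
  \<open>T \<inter> C\<close>, which vanishes unless \<open>T \<inter> C = {}\<close>.
\<close>
lemma alternating_sum_eq_sum_upper_moebius_avoiding:
  assumes "finite N" "C \<subseteq> N"
  shows "(\<Sum>S \<in> Pow C. f S * (-1) ^ card S) =
         (\<Sum>T \<in> {T \<in> Pow N. T \<inter> C = {}}. upper_moebius N f T)"
proof -
  have fin: "finite C"
    using assms finite_subset by blast
  have "(\<Sum>S \<in> Pow C. f S * (-1) ^ card S) =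
        (\<Sum>S \<in> Pow C. \<Sum>T \<in> {T \<in> Pow N. S \<subseteq> T}. (-1) ^ card S * upper_moebius N f T)"
  proof (rule sum.cong[OF refl])
    fix S assume "S \<in> Pow C"
    then have "f S = (\<Sum>T \<in> {T \<in> Pow N. S \<subseteq> T}. upper_moebius N f T)"
      using upper_moebius_inversion[of N S f] assms by auto
    then show "f S * (-1) ^ card S =
        (\<Sum>T \<in> {T \<in> Pow N. S \<subseteq> T}. (-1) ^ card S * upper_moebius N f T)"
      by (simp add: sum_distrib_left mult.commute)
  qed
  also have "\<dots> = (\<Sum>T \<in> Pow N. \<Sum>S \<in> {S \<in> Pow C. S \<subseteq> T}. (-1) ^ card S * upper_moebius N f T)"
    by (rule sum.swap_restrict) (use assms fin in auto)
  also have "\<dots> = (\<Sum>T \<in> Pow N. if T \<inter> C = {} then upper_moebius N f T else 0)"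
  proof (rule sum.cong[OF refl])
    fix T
    have "{S \<in> Pow C. S \<subseteq> T} = Pow (T \<inter> C)"
      by auto
    then show "(\<Sum>S \<in> {S \<in> Pow C. S \<subseteq> T}. (-1) ^ card S * upper_moebius N f T) =
        (if T \<inter> C = {} then upper_moebius N f T else 0)"
      using alternating_sum_Pow[of "T \<inter> C"] fin by (simp flip: sum_distrib_right)
  qed
  also have "\<dots> = (\<Sum>T \<in> {T \<in> Pow N. T \<inter> C = {}}. upper_moebius N f T)"
    by (rule sum.inter_filter[symmetric]) (use assms in simp)
  finally show ?thesis .
qed


section \<open>Decomposing an integer vector with non-negative upset sums\<close>

text \<open>
  Unlike the classes in (b), an upset may be empty or contain \<open>{}\<close>, so that upsets are closed under
  intersection and union.
\<close>
definition upset_over :: "'a set \<Rightarrow> 'a set set \<Rightarrow> bool" where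
  "upset_over N \<U> \<longleftrightarrow> \<U> \<subseteq> Pow N \<and> (\<forall>S T. S \<in> \<U> \<longrightarrow> S \<subseteq> T \<longrightarrow> T \<subseteq> N \<longrightarrow> T \<in> \<U>)"

definition lift_unit :: "'a \<Rightarrow> 'a set \<Rightarrow> 'a set \<Rightarrow> int" where
  "lift_unit i A S = of_bool (S = insert i A) - of_bool (S = A)"

lemma sum_lift_unit:
  assumes "finite \<U>"
  shows "(\<Sum>S \<in> \<U>. lift_unit i A S) = of_bool (insert i A \<in> \<U>) - of_bool (A \<in> \<U>)"
  using assms by (simp add: lift_unit_def sum_subtractf of_bool_def)

lemma finite_upset_over: "finite N \<Longrightarrow> upset_over N \<U> \<Longrightarrow> finite \<U>"
  unfolding upset_over_def by (meson finite_Pow_iff finite_subset)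

lemma upset_over_containing: "upset_over N {T \<in> Pow N. X \<subseteq> T}"
  by (auto simp: upset_over_def)

lemma upset_overI:
  assumes "\<U> \<subseteq> Pow N" "\<And>S T. S \<in> \<U> \<Longrightarrow> S \<subseteq> T \<Longrightarrow> T \<subseteq> N \<Longrightarrow> T \<in> \<U>"
  shows "upset_over N \<U>"
  using assms unfolding upset_over_def by blast

lemma upset_overD:
  assumes "upset_over N \<U>" "S \<in> \<U>" "S \<subseteq> T" "T \<subseteq> N"
  shows "T \<in> \<U>"
  using assms unfolding upset_over_def by blast

lemma upset_over_subset: "upset_over N \<U> \<Longrightarrow> \<U> \<subseteq> Pow N"
  by (simp add: upset_over_def)

lemma upset_over_Int:
  assumes "upset_over N \<U>" "upset_over N \<V>"
  shows "upset_over N (\<U> \<inter> \<V>)"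
  using upset_over_subset[OF assms(1)]
  by (intro upset_overI) (simp add: le_infI1, metis Int_iff upset_overD assms)

lemma upset_over_Un:
  assumes "upset_over N \<U>" "upset_over N \<V>"
  shows "upset_over N (\<U> \<union> \<V>)"
  using upset_over_subset[OF assms(1)] upset_over_subset[OF assms(2)]
  by (intro upset_overI) (simp, metis Un_iff upset_overD assms)

text \<open>
  The sum over families is modular, and the union and the intersection of upsets are upsets; two
  non-negative numbers with sum 0 are both 0.
\<close>
lemma sum_tight_upsets_Int:
  fixes m :: "'a set \<Rightarrow> int"
  assumes fin: "finite N"
    and nonneg: "\<And>\<U>. upset_over N \<U> \<Longrightarrow> 0 \<le> sum m \<U>"
    and "upset_over N \<U>" "sum m \<U> = 0" "upset_over N \<V>" "sum m \<V> = 0"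
  shows "sum m (\<U> \<inter> \<V>) = 0"
proof -
  have "sum m (\<U> \<union> \<V>) + sum m (\<U> \<inter> \<V>) = 0"
    using sum.union_inter[of \<U> \<V> m] assms(4,6) finite_upset_over[OF fin] assms(3,5) by simp
  then show ?thesis
    using nonneg[OF upset_over_Int[OF assms(3,5)]] nonneg[OF upset_over_Un[OF assms(3,5)]]
    by linarith
qed

text \<open>
  The augmentation step. Only a tight upset (one with sum 0) that contains \<open>B\<close> but not \<open>B - {i}\<close> can
  block it, and a suitable \<open>i\<close> is read off from the least tight upset containing \<open>B\<close>.
\<close>
lemma ex_lift_unit_removable:
  fixes m :: "'a set \<Rightarrow> int"
  assumes fin: "finite N"
    and nonneg: "\<And>\<U>. upset_over N \<U> \<Longrightarrow> 0 \<le> sum m \<U>"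
    and total: "sum m (Pow N) = 0"
    and B: "B \<subseteq> N" "0 < m B"
  obtains i where "i \<in> B"
    and "\<And>\<U>. upset_over N \<U> \<Longrightarrow> 0 \<le> (\<Sum>S \<in> \<U>. m S - lift_unit i (B - {i}) S)"
proof -
  define \<T> where "\<T> = {\<U>. upset_over N \<U> \<and> sum m \<U> = 0 \<and> B \<in> \<U>}"
  have "Pow N \<in> \<T>"
    using total B by (auto simp: \<T>_def upset_over_def)
  have "\<T> \<subseteq> Pow (Pow N)"
    by (auto simp: \<T>_def upset_over_def)
  then have "finite \<T>"
    using fin by (meson finite_Pow_iff finite_subset)
  then obtain \<U> where \<U>: "\<U> \<in> \<T>" and min: "\<And>\<V>. \<V> \<in> \<T> \<Longrightarrow> \<V> \<subseteq> \<U> \<Longrightarrow> \<V> = \<U>"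
    using finite_has_minimal[of \<T>] \<open>Pow N \<in> \<T>\<close> by (metis empty_iff)
  have least: "\<U> \<subseteq> \<V>" if "\<V> \<in> \<T>" for \<V>
  proof -
    have "\<U> \<inter> \<V> \<in> \<T>"
      using sum_tight_upsets_Int[OF fin nonneg, of \<U> \<V>] upset_over_Int[of N \<U> \<V>] \<U> that
      by (simp add: \<T>_def)
    then show ?thesis
      using min by blast
  qed
  have up: "upset_over N \<U>" and "sum m \<U> = 0" and "B \<in> \<U>"
    using \<U> by (auto simp: \<T>_def)
  \<comment> \<open>Otherwise \<open>B\<close> is minimal in \<open>\<U>\<close>, and \<open>\<U> - {B}\<close> is an upset with sum \<open>- m B < 0\<close>.\<close>
  have "\<exists>i \<in> B. B - {i} \<in> \<U>"
  proof (rule ccontr)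
    assume none: "\<not> (\<exists>i \<in> B. B - {i} \<in> \<U>)"
    have ne_B: "T \<noteq> B" if S: "S \<in> \<U> - {B}" "S \<subseteq> T" for S T
    proof
      assume "T = B"
      then obtain i where "i \<in> B" "i \<notin> S"
        using S by blast
      then have "B - {i} \<in> \<U>"
        using upset_overD[OF up, of S "B - {i}"] S \<open>T = B\<close> B by blast
      then show False
        using none \<open>i \<in> B\<close> by blast
    qed
    have "upset_over N (\<U> - {B})"
    proof (rule upset_overI)
      show "\<U> - {B} \<subseteq> Pow N"
        using upset_over_subset[OF up] by blast
      show "T \<in> \<U> - {B}" if "S \<in> \<U> - {B}" "S \<subseteq> T" "T \<subseteq> N" for S T
        using upset_overD[OF up _ that(2,3)] that(1) ne_B[OF that(1,2)] by blast
    qed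
    then have "0 \<le> sum m (\<U> - {B})"
      by (rule nonneg)
    then show False
      using sum.remove[of \<U> B m] finite_upset_over[OF fin up] \<open>B \<in> \<U>\<close> \<open>sum m \<U> = 0\<close> B by simp
  qed
  then obtain i where i: "i \<in> B" "B - {i} \<in> \<U>"
    by blast
  have "0 \<le> (\<Sum>S \<in> \<V>. m S - lift_unit i (B - {i}) S)" if \<V>: "upset_over N \<V>" for \<V>
  proof -
    have "(\<Sum>S \<in> \<V>. m S - lift_unit i (B - {i}) S) =
          sum m \<V> - (of_bool (B \<in> \<V>) - of_bool (B - {i} \<in> \<V>))"
      using i finite_upset_over[OF fin \<V>] by (simp add: sum_subtractf sum_lift_unit insert_absorb)
    moreover have "0 \<le> sum m \<V>"
      using \<V> by (rule nonneg)
    moreover have "B - {i} \<in> \<V>" if "sum m \<V> = 0" "B \<in> \<V>"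
      using least[of \<V>] that \<V> i by (auto simp: \<T>_def)
    \<comment> \<open>Integrality enters here: a non-tight upset has sum at least 1.\<close>
    ultimately show ?thesis
      by (cases "sum m \<V> = 0") auto
  qed
  with i show thesis
    using that by blast
qed

text \<open>
  The set \<open>M\<close> collects the nodes that still have to be lifted. Each augmentation step at \<open>i\<close> lowers
  the sum over the sets containing \<open>i\<close>, and no other such sum; as it cannot become negative, \<open>i\<close> was in
  \<open>M\<close>, and it is removed. Steps are possible as long as \<open>m\<close> does not vanish, and \<open>m = 0\<close> forces \<open>M = {}\<close>.
\<close>
lemma decompose_into_lift_units:
  fixes m :: "'a set \<Rightarrow> int"
  assumes fin: "finite N" and "M \<subseteq> N"
    and "\<And>\<U>. upset_over N \<U> \<Longrightarrow> 0 \<le> sum m \<U>"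
    and "sum m (Pow N) = 0"
    and "\<And>i. i \<in> N \<Longrightarrow> sum m {T \<in> Pow N. i \<in> T} = of_bool (i \<in> M)"
  shows "\<exists>P. (\<forall>i \<in> M. P i \<subseteq> N - {i}) \<and> (\<forall>S \<in> Pow N. m S = (\<Sum>i \<in> M. lift_unit i (P i) S))"
proof -
  have "finite M"
    using assms(1,2) finite_subset by blast
  then show ?thesis
    using assms(2-)
  proof (induction M arbitrary: m rule: finite_psubset_induct)
    case (psubset M)
    note nonneg = psubset.prems(2) and total = psubset.prems(3) and single = psubset.prems(4)
    show ?case
    proof (cases "\<forall>S \<in> Pow N. m S = 0")
      case True
      then have "sum m {T \<in> Pow N. i \<in> T} = 0" for i
        by (intro sum.neutral) auto
      then have "i \<notin> M" for i
        using single[of i] psubset.prems(1) by auto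
      then have "M = {}"
        by blast
      then show ?thesis
        using True by (simp del: Pow_iff)
    next
      case False
      have "\<exists>B \<in> Pow N. 0 < m B"
      proof (rule ccontr)
        assume "\<not> (\<exists>B \<in> Pow N. 0 < m B)"
        then have "0 \<le> - m S" if "S \<in> Pow N" for S
          using that by (meson neg_0_le_iff_le not_le)
        moreover have "(\<Sum>S \<in> Pow N. - m S) = 0"
          using total by (simp only: sum_negf neg_equal_zero)
        ultimately have "\<forall>S \<in> Pow N. - m S = 0"
          using fin sum_nonneg_eq_0_iff[of "Pow N" "\<lambda>S. - m S"] by blast
        then show False
          using False by (simp only: neg_equal_0_iff_equal)
      qed
      then obtain B where B: "B \<subseteq> N" "0 < m B"
        by blast
      obtain i where i: "i \<in> B"
        and nonneg': "\<And>\<U>. upset_over N \<U> \<Longrightarrow> 0 \<le> (\<Sum>S \<in> \<U>. m S - lift_unit i (B - {i}) S)"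
        using ex_lift_unit_removable[OF fin nonneg total B] by blast
      define m' where "m' S = m S - lift_unit i (B - {i}) S" for S
      have sum_m': "sum m' \<U> = sum m \<U> - (of_bool (B \<in> \<U>) - of_bool (B - {i} \<in> \<U>))"
        if "\<U> \<subseteq> Pow N" for \<U>
        using i finite_subset[OF that] fin
        by (simp add: m'_def sum_subtractf sum_lift_unit insert_absorb)
      have single': "sum m' {T \<in> Pow N. j \<in> T} = of_bool (j \<in> M) - of_bool (j = i)"
        if "j \<in> N" for j
      proof -
        have "B - {i} \<in> Pow N"
          using B by blast
        then show ?thesis
          using single[OF that] sum_m'[OF Collect_restrict, of "\<lambda>T. j \<in> T"] i B
          by (cases "j = i") simp_all
      qed
      have "0 \<le> sum m' {T \<in> Pow N. i \<in> T}"
        using nonneg'[OF upset_over_containing[of N "{i}"]] by (simp add: m'_def)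
      then have "i \<in> M"
        using single'[of i] i B by (cases "i \<in> M") (auto simp: subset_iff)
      have "\<exists>P. (\<forall>j \<in> M - {i}. P j \<subseteq> N - {j}) \<and>
            (\<forall>S \<in> Pow N. m' S = (\<Sum>j \<in> M - {i}. lift_unit j (P j) S))"
      proof (rule psubset.IH)
        show "M - {i} \<subset> M" "M - {i} \<subseteq> N"
          using \<open>i \<in> M\<close> psubset.prems(1) by auto
        show "0 \<le> sum m' \<U>" if "upset_over N \<U>" for \<U>
          using nonneg'[OF that] by (simp add: m'_def)
        show "sum m' (Pow N) = 0"
          using sum_m'[OF subset_refl] total B by (simp add: subset_iff)
        show "sum m' {T \<in> Pow N. j \<in> T} = of_bool (j \<in> M - {i})" if "j \<in> N" for j
          using single'[OF that] \<open>i \<in> M\<close> by auto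
      qed
      then obtain P where P: "\<forall>j \<in> M - {i}. P j \<subseteq> N - {j}"
        "\<forall>S \<in> Pow N. m' S = (\<Sum>j \<in> M - {i}. lift_unit j (P j) S)"
        by blast
      define Q where "Q = P(i := B - {i})"
      have "m S = (\<Sum>j \<in> M. lift_unit j (Q j) S)" if "S \<in> Pow N" for S
      proof -
        have "(\<Sum>j \<in> M. lift_unit j (Q j) S) =
              lift_unit i (Q i) S + (\<Sum>j \<in> M - {i}. lift_unit j (Q j) S)"
          using \<open>finite M\<close> \<open>i \<in> M\<close> by (rule sum.remove)
        also have "(\<Sum>j \<in> M - {i}. lift_unit j (Q j) S) = (\<Sum>j \<in> M - {i}. lift_unit j (P j) S)"
          by (rule sum.cong) (auto simp: Q_def)
        also have "\<dots> = m' S"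
          using P(2) that by simp
        finally show ?thesis
          by (simp add: Q_def m'_def)
      qed
      moreover have "\<forall>j \<in> M. Q j \<subseteq> N - {j}"
        using P(1) B by (auto simp: Q_def)
      ultimately show ?thesis
        by blast
    qed
  qed
qed


section \<open>Lattice points are characteristic imsets\<close>

lemma alternating_sum_split_small:
  fixes f :: "'a set \<Rightarrow> real"
  assumes "finite C" "f {} = 1" "\<And>i. i \<in> C \<Longrightarrow> f {i} = 1"
  shows "(\<Sum>S \<in> Pow C. f S * (-1) ^ card S) =
         1 - real (card C) + (\<Sum>S \<in> {S. S \<subseteq> C \<and> 2 \<le> card S}. f S * (-1) ^ card S)"
proof -
  let ?small = "insert {} ((\<lambda>i. {i}) ` C)" and ?large = "{S. S \<subseteq> C \<and> 2 \<le> card S}"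
  have "S \<in> ?small" if "S \<subseteq> C" "\<not> 2 \<le> card S" for S
  proof -
    have "card S = 0 \<or> card S = 1"
      using that by linarith
    then show ?thesis
      using that assms(1) finite_subset by (auto simp: card_1_singleton_iff)
  qed
  then have "Pow C = ?small \<union> ?large"
    by auto
  moreover have "(\<Sum>S \<in> ?small \<union> ?large. f S * (-1) ^ card S) =
      (\<Sum>S \<in> ?small. f S * (-1) ^ card S) + (\<Sum>S \<in> ?large. f S * (-1) ^ card S)"
    by (rule sum.union_disjoint) (use assms(1) in auto)
  moreover have "(\<Sum>S \<in> (\<lambda>i. {i}) ` C. f S * (-1) ^ card S) = - real (card C)"
    using assms(3) by (simp add: sum.reindex)
  then have "(\<Sum>S \<in> ?small. f S * (-1) ^ card S) = 1 - real (card C)"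
    using assms(1,2) by (subst sum.insert) auto
  ultimately show ?thesis
    by simp
qed

text \<open>
  The nodes of a directed cycle would form a cluster in which every node has a parent. Formally,
  the hypothesis says that \<open>G\<close> is well-founded.
\<close>
lemma acyclic_if_clusters_have_source:
  assumes "G \<subseteq> N \<times> N"
    and "\<And>C. C \<subseteq> N \<Longrightarrow> C \<noteq> {} \<Longrightarrow> \<exists>i \<in> C. \<forall>j \<in> C. (j, i) \<notin> G"
  shows "acyclic G"
proof (rule wf_acyclic, rule wfI_min)
  fix x :: 'a and Q assume "x \<in> Q"
  show "\<exists>z \<in> Q. \<forall>y. (y, z) \<in> G \<longrightarrow> y \<notin> Q"
  proof (cases "x \<in> N")
    case True
    then show ?thesis
      using assms(1) assms(2)[of "Q \<inter> N"] \<open>x \<in> Q\<close> by blast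
  next
    case False
    then show ?thesis
      using assms(1) \<open>x \<in> Q\<close> by blast
  qed
qed

text \<open>
  The standard imset is \<open>\<delta>\<^sub>N - \<mu>\<close>, where \<open>\<mu>\<close> is the summand on the right, and \<open>\<delta>\<^sub>N\<close>
  contributes 1 to each sum over the supersets of \<open>S\<close>, which cancels the 1 in the definition of
  the characteristic imset.
\<close>
lemma characteristic_imset_eq_sum_lift_units:
  assumes "finite N" "S \<subseteq> N"
  shows "characteristic_imset N G S =
    (\<Sum>T \<in> {T \<in> Pow N. S \<subseteq> T}.
       of_bool (T = {}) + (\<Sum>i \<in> N. of_int (lift_unit i (parents N G i) T)))"
proof -
  have "standard_imset N G T =
      of_bool (T = N) -
      (of_bool (T = {}) + (\<Sum>i \<in> N. of_int (lift_unit i (parents N G i) T)))"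
    if "T \<subseteq> N" for T
  proof -
    have "(\<Sum>i \<in> N. delta N (parents N G i) T - delta N ({i} \<union> parents N G i) T) =
          - (\<Sum>i \<in> N. of_int (lift_unit i (parents N G i) T))"
      unfolding sum_negf[symmetric]
      by (rule sum.cong) (use that in \<open>auto simp: delta_def lift_unit_def\<close>)
    then show ?thesis
      using that by (simp add: standard_imset_def delta_def)
  qed
  then have "(\<Sum>T \<in> {T \<in> Pow N. S \<subseteq> T}. standard_imset N G T) =
    (\<Sum>T \<in> {T \<in> Pow N. S \<subseteq> T}. of_bool (T = N) -
      (of_bool (T = {}) + (\<Sum>i \<in> N. of_int (lift_unit i (parents N G i) T))))"
    by (intro sum.cong) auto
  also have "\<dots> = 1 - (\<Sum>T \<in> {T \<in> Pow N. S \<subseteq> T}.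
      of_bool (T = {}) + (\<Sum>i \<in> N. of_int (lift_unit i (parents N G i) T)))"
    using assms by (subst sum_subtractf) (simp add: of_bool_def)
  finally show ?thesis
    using assms by (simp add: characteristic_imset_def conj_commute Pow_def)
qed

theorem corollary21:
  fixes N :: "'a set" and c :: "'a set \<Rightarrow> real"
  assumes "finite N" and "card N \<ge> 2"
    and "c \<in> imset_polyhedron N"
    and "c \<in> Pow N \<rightarrow>\<^sub>E \<int>"
  shows "\<exists>G. digraph_over N G \<and> acyclic G \<and> c = characteristic_imset N G"
proof -
  note fin = \<open>finite N\<close>
  have small: "c S = 1" if "S \<subseteq> N" "card S \<le> 1" for S
    using assms(3) that by (simp add: imset_polyhedron_def)
  have upset_ineq: "0 \<le> (\<Sum>S \<in> Pow N. kappa \<A> S * c S)" if "superset_closed_class N \<A>" for \<A>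
    using assms(3) that by (simp add: imset_polyhedron_def)
  have cluster_ineq:
    "(\<Sum>S \<in> {S. S \<subseteq> C \<and> 2 \<le> card S}. c S * (-1) ^ card S) \<le> real (card C) - 1"
    if "C \<subseteq> N" "2 \<le> card C" for C
    using assms(3) that by (simp add: imset_polyhedron_def)

  \<comment> \<open>Subtracting \<open>\<delta>\<^sub>\<emptyset>\<close> leaves the classes in (b) untouched, as they omit \<open>{}\<close>, and makes
    the sum over \<open>Pow N\<close>, the only upset containing \<open>{}\<close>, equal to 0.\<close>
  define \<mu> where "\<mu> = upper_moebius N c"
  define m where "m T = \<lfloor>\<mu> T\<rfloor> - of_bool (T = {})" for T
  have "\<mu> T \<in> \<int>" for T
    unfolding \<mu>_def upper_moebius_def
    by (intro Ints_sum Ints_mult Ints_power) (use assms(4) in auto)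
  then have m: "real_of_int (m T) = \<mu> T - of_bool (T = {})" for T
    by (auto simp: m_def elim: Ints_cases)
  have sum_m: "real_of_int (sum m \<U>) = sum \<mu> \<U> - of_bool ({} \<in> \<U>)" if "\<U> \<subseteq> Pow N" for \<U>
    using finite_subset[OF that] fin by (simp add: m sum_subtractf of_bool_def)
  have total: "sum m (Pow N) = 0"
    using upper_moebius_inversion[OF fin, of "{}" c] small[of "{}"] sum_m[of "Pow N"]
    by (simp add: \<mu>_def Pow_def del: of_int_sum)
  have single: "sum m {T \<in> Pow N. i \<in> T} = of_bool (i \<in> N)" if "i \<in> N" for i
    using upper_moebius_inversion[OF fin, of "{i}" c] small[of "{i}"]
      sum_m[of "{T \<in> Pow N. i \<in> T}", OF Collect_restrict] that
    by (simp add: \<mu>_def del: of_int_sum)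
  have nonneg: "0 \<le> sum m \<U>" if \<U>: "upset_over N \<U>" for \<U>
  proof (cases "\<U> = {} \<or> {} \<in> \<U>")
    case True
    then have "\<U> = {} \<or> \<U> = Pow N"
      using \<U> unfolding upset_over_def by blast
    then show ?thesis
      using total by auto
  next
    case False
    then have "superset_closed_class N \<U>"
      using \<U> unfolding upset_over_def superset_closed_class_def by blast
    then have "0 \<le> sum \<mu> \<U>"
      using upset_ineq[of \<U>] sum_upper_moebius[OF fin, of \<U> c] \<U>
      by (simp add: \<mu>_def kappa_def upset_over_def)
    then show ?thesis
      using sum_m[of \<U>] False \<U> by (simp add: upset_over_def del: of_int_sum)
  qed
  have "\<exists>P. (\<forall>i \<in> N. P i \<subseteq> N - {i}) \<and> (\<forall>S \<in> Pow N. m S = (\<Sum>i \<in> N. lift_unit i (P i) S))"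
    using fin subset_refl nonneg total single by (rule decompose_into_lift_units)
  then obtain P where P: "\<forall>i \<in> N. P i \<subseteq> N - {i}"
    and m_eq: "\<forall>S \<in> Pow N. m S = (\<Sum>i \<in> N. lift_unit i (P i) S)"
    by blast

  define G where "G = {(j, i). i \<in> N \<and> j \<in> P i}"
  have parents: "parents N G i = P i" if "i \<in> N" for i
    using P that by (auto simp: parents_def G_def)
  have digraph: "digraph_over N G"
    using P by (fastforce simp: digraph_over_def G_def irrefl_def)
  have "\<exists>i \<in> C. \<forall>j \<in> C. (j, i) \<notin> G" if C: "C \<subseteq> N" "C \<noteq> {}" for C
  proof (cases "2 \<le> card C")
    case False
    have "finite C"
      using C fin finite_subset by blast
    then have "card C = 1"
      using False C card_gt_0_iff[of C] by linarith
    then show ?thesis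
      using digraph by (auto simp: digraph_over_def irrefl_def card_1_singleton_iff)
  next
    case True
    have finC: "finite C"
      using C fin finite_subset by blast
    have "sum \<mu> {T \<in> Pow N. T \<inter> C = {}} = (\<Sum>S \<in> Pow C. c S * (-1) ^ card S)"
      using alternating_sum_eq_sum_upper_moebius_avoiding[OF fin C(1)] by (simp add: \<mu>_def)
    also have "\<dots> = 1 - real (card C) + (\<Sum>S \<in> {S. S \<subseteq> C \<and> 2 \<le> card S}. c S * (-1) ^ card S)"
      by (rule alternating_sum_split_small) (use finC C small in auto)
    finally have "sum \<mu> {T \<in> Pow N. T \<inter> C = {}} \<le> 0"
      using cluster_ineq[OF C(1) True] by linarith
    then have "sum m {T \<in> Pow N. T \<inter> C = {}} < 0"
      using sum_m[of "{T \<in> Pow N. T \<inter> C = {}}", OF Collect_restrict] by (simp del: of_int_sum)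
    also have "sum m {T \<in> Pow N. T \<inter> C = {}} =
        (\<Sum>i \<in> N. \<Sum>T \<in> {T \<in> Pow N. T \<inter> C = {}}. lift_unit i (P i) T)"
      using m_eq by (subst sum.swap) (auto intro: sum.cong)
    \<comment> \<open>The unit of \<open>i\<close> leaves the family of sets avoiding \<open>C\<close> iff \<open>P i\<close> avoids \<open>C\<close> and \<open>i \<in> C\<close>.\<close>
    also have "\<dots> = (\<Sum>i \<in> N. - of_bool (i \<in> C \<and> P i \<inter> C = {}))"
      by (rule sum.cong) (use P fin in \<open>auto simp: sum_lift_unit\<close>)
    finally have neg: "(\<Sum>i \<in> N. - of_bool (i \<in> C \<and> P i \<inter> C = {})) < (0 :: int)" .
    have "\<exists>i. i \<in> C \<and> P i \<inter> C = {}"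
    proof (rule ccontr)
      assume "\<nexists>i. i \<in> C \<and> P i \<inter> C = {}"
      then have "(\<Sum>i \<in> N. - of_bool (i \<in> C \<and> P i \<inter> C = {})) = (0 :: int)"
        by (intro sum.neutral) auto
      then show False
        using neg by linarith
    qed
    then show ?thesis
      by (auto simp: G_def)
  qed
  then have "acyclic G"
    using digraph acyclic_if_clusters_have_source[of G N] by (simp add: digraph_over_def)
  moreover have "c = characteristic_imset N G"
  proof
    fix S
    show "c S = characteristic_imset N G S"
    proof (cases "S \<subseteq> N")
      case False
      then show ?thesis
        using PiE_arb[OF assms(4), of S] by (simp add: characteristic_imset_def)
    next
      case True
      have "\<mu> T = of_bool (T = {}) + (\<Sum>i \<in> N. of_int (lift_unit i (parents N G i) T))"
        if "T \<in> Pow N" for T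
      proof -
        have "m T = (\<Sum>i \<in> N. lift_unit i (parents N G i) T)"
          using bspec[OF m_eq that] parents by simp
        then show ?thesis
          using m[of T] by simp
      qed
      then have "characteristic_imset N G S = (\<Sum>T \<in> {T \<in> Pow N. S \<subseteq> T}. \<mu> T)"
        unfolding characteristic_imset_eq_sum_lift_units[OF fin True] by (intro sum.cong) auto
      then show ?thesis
        using upper_moebius_inversion[OF fin True] by (simp add: \<mu>_def)
    qed
  qed
  ultimately show ?thesis
    using digraph by blast
qed

end
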